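(* Let $\mathcal{T}=(\mathcal{V},\mathcal{E})$ be a tree with $\mathcal{V}=\{1,\ldots,d\}$, let $q\in(0,1)$ and $\boldsymbol{\alpha}=(\alpha_e,\,e\in\mathcal{E})\in(0,1)^{d-1}$. Let $\boldsymbol{J}$ be the tree-structured Ising model on $\mathcal{T}$ mean-parameterized by $\boldsymbol{q}=(q,\ldots,q)$ and $\boldsymbol{\alpha}$, and let $\boldsymbol{N}\sim\mathrm{MPMRF}(q,\boldsymbol{\alpha},\mathcal{T})$. Then $$d_{\mathrm{TV}}(\boldsymbol{N},\boldsymbol{J})\leq d\,q\,(1-\mathrm{e}^{-q});$$ in particular, $d_{\mathrm{TV}}(\boldsymbol{N},\boldsymbol{J})\to0$ as $q\to0$ (with $\mathcal{T}$ and $\boldsymbol{\alpha}$ fixed).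
   Context: Total variation distance between $d$-dimensional random vectors: $d_{\mathrm{TV}}(\boldsymbol{X},\boldsymbol{Y})=\sup_{A\in\mathcal{B}(\mathbb{R}^d)}|\Pr(\boldsymbol{X}\in A)-\Pr(\boldsymbol{Y}\in A)|$, with $\mathcal{B}(\mathbb{R}^d)$ the Borel sets. For a root $r\in\mathcal{V}$: $\mathrm{dsc}(r)=\mathcal{V}\setminus\{r\}$ and $\mathrm{pa}(v)$, $v\neq r$, is the neighbor of $v$ on the path from $v$ to $r$. Tree-structured Ising model mean-parameterized by $\boldsymbol{q}=(q_v)_{v\in\mathcal{V}}$ and $\boldsymbol{\alpha}$ on $\mathcal{T}$: the random vector $\boldsymbol{J}$ on $\{0,1\}^d$ whose pmf has the form $p_{\boldsymbol{J}}(\boldsymbol{x})=\exp(\sum_{v\in\mathcal{V}}\eta_vx_v+\sum_{(u,v)\in\mathcal{E}}\eta_{(u,v)}x_ux_v-A(\boldsymbol{\eta}))$ for real parameters $\boldsymbol{\eta}$ and normalizing constant $A(\boldsymbol{\eta})$, with $\mathrm{E}[J_v]=q_v$ for all $v\in\mathcal{V}$ and Pearson correlation $\mathrm{Corr}(J_u,J_v)=\alpha_{(u,v)}$ for all edges $(u,v)\in\mathcal{E}$. Equivalently, for any root $r$, with $p_v(x)=q_v^{x}(1-q_v)^{1-x}$ and $\sigma_{(u,v)}=\sqrt{q_uq_v(1-q_u)(1-q_v)}$, $$p_{\boldsymbol{J}}(\boldsymbol{x})=p_r(x_r)\prod_{v\neq r}\frac{p_v(x_v)\,p_{\mathrm{pa}(v)}(x_{\mathrm{pa}(v)})+\alpha_{(\mathrm{pa}(v),v)}(-1)^{x_v+x_{\mathrm{pa}(v)}}\sigma_{(\mathrm{pa}(v),v)}}{p_{\mathrm{pa}(v)}(x_{\mathrm{pa}(v)})},\quad\boldsymbol{x}\in\{0,1\}^d.$$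 Binomial thinning: for $\alpha\in(0,1)$ and an $\mathbb{N}$-valued random variable $X$, $\alpha\circ X=\sum_{i=1}^XI_i$, where $(I_i)_{i\geq1}$ are i.i.d. Bernoulli$(\alpha)$, independent of $X$. $\mathrm{MPMRF}(\lambda,\boldsymbol{\alpha},\mathcal{T})$, for $\lambda>0$ and $\boldsymbol{\alpha}\in(0,1)^{d-1}$: the distribution of $\boldsymbol{N}=(N_v,\,v\in\mathcal{V})$ constructed, for a chosen root $r$, by $N_r=L_r$ and $N_v=\alpha_{(\mathrm{pa}(v),v)}\circ N_{\mathrm{pa}(v)}+L_v$ for $v\in\mathrm{dsc}(r)$, where $(L_v,\,v\in\mathcal{V})$ are independent Poisson random variables, $L_r$ with mean $\lambda$ and $L_v$ with mean $\lambda(1-\alpha_{(\mathrm{pa}(v),v)})$ for $v\neq r$, and the Bernoulli sequences used in the thinnings are mutually independent across vertices and independent of $(L_v)$. Its distribution does not depend on the choice of $r$, and each $N_v$ is Poisson with mean $\lambda$. *)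

theory Defs
  imports "HOL-Probability.Probability"
begin

text \<open>
  The vertex set is a finite type \<open>'v\<close>, so that \<open>d = CARD('v)\<close> and the ambient space is
  \<open>real ^ 'v\<close>. Edges are two-element sets of vertices, and edge parameters are functions on edges.
\<close>

definition is_path :: "'v set set \<Rightarrow> 'v \<Rightarrow> 'v list \<Rightarrow> 'v \<Rightarrow> bool" where
  "is_path E u p w \<longleftrightarrow>
     p \<noteq> [] \<and> hd p = u \<and> last p = w \<and> distinct p \<and> successively (\<lambda>a b. {a, b} \<in> E) p"

definition is_cycle :: "'v set set \<Rightarrow> 'v list \<Rightarrow> bool" where
  "is_cycle E p \<longleftrightarrow>
     3 \<le> length p \<and> distinct p \<and> successively (\<lambda>a b. {a, b} \<in> E) p \<and> {last p, hd p} \<in> E"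

definition is_tree :: "'v::finite set set \<Rightarrow> bool" where
  "is_tree E \<longleftrightarrow>
     (\<forall>e\<in>E. card e = 2) \<and> (\<forall>u w. \<exists>p. is_path E u p w) \<and> (\<nexists>p. is_cycle E p)"

definition dsc :: "'v \<Rightarrow> 'v set" where
  "dsc r = UNIV - {r}"

definition pa :: "'v set set \<Rightarrow> 'v \<Rightarrow> 'v \<Rightarrow> 'v" where
  "pa E r v = (THE u. \<exists>p. is_path E v (v # u # p) r)"

definition d_TV ::
  "'a measure \<Rightarrow> ('a \<Rightarrow> 'c::topological_space) \<Rightarrow> 'b measure \<Rightarrow> ('b \<Rightarrow> 'c) \<Rightarrow> real" where
  "d_TV M X M' Y =
     (SUP A\<in>sets borel. \<bar>\<P>(\<omega> in M. X \<omega> \<in> A) - \<P>(\<omega> in M'. Y \<omega> \<in> A)\<bar>)"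

definition correlation :: "'a measure \<Rightarrow> ('a \<Rightarrow> real) \<Rightarrow> ('a \<Rightarrow> real) \<Rightarrow> real" where
  "correlation M X Y =
     prob_space.expectation M
       (\<lambda>\<omega>. (X \<omega> - prob_space.expectation M X) * (Y \<omega> - prob_space.expectation M Y))
     / (sqrt (prob_space.variance M X) * sqrt (prob_space.variance M Y))"

definition binary_vectors :: "(real ^ 'v) set" where
  "binary_vectors = {x. \<forall>v. x $ v \<in> {0, 1}}"

text \<open>For an edge \<open>e = {u, v}\<close>, the factor \<open>\<Prod>v\<in>e. x $ v\<close> is \<open>x\<^sub>u x\<^sub>v\<close>.\<close>

definition ising_exponent ::
  "'v::finite set set \<Rightarrow> ('v \<Rightarrow> real) \<Rightarrow> ('v set \<Rightarrow> real) \<Rightarrow> real ^ 'v \<Rightarrow> real" where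
  "ising_exponent E \<eta> \<eta>' x = (\<Sum>v\<in>UNIV. \<eta> v * x $ v) + (\<Sum>e\<in>E. \<eta>' e * (\<Prod>v\<in>e. x $ v))"

definition log_partition ::
  "'v::finite set set \<Rightarrow> ('v \<Rightarrow> real) \<Rightarrow> ('v set \<Rightarrow> real) \<Rightarrow> real" where
  "log_partition E \<eta> \<eta>' = ln (\<Sum>x\<in>binary_vectors. exp (ising_exponent E \<eta> \<eta>' x))"

definition is_tree_ising ::
  "'a measure \<Rightarrow> ('a \<Rightarrow> real ^ 'v::finite) \<Rightarrow> ('v \<Rightarrow> real) \<Rightarrow> ('v set \<Rightarrow> real) \<Rightarrow> 'v set set \<Rightarrow> bool"
where
  "is_tree_ising M J q \<alpha> E \<longleftrightarrow>
     prob_space M \<and> J \<in> borel_measurable M \<and> (AE \<omega> in M. J \<omega> \<in> binary_vectors) \<and>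
     (\<exists>\<eta> \<eta>'. \<forall>x\<in>binary_vectors.
        \<P>(\<omega> in M. J \<omega> = x) = exp (ising_exponent E \<eta> \<eta>' x - log_partition E \<eta> \<eta>')) \<and>
     (\<forall>v. prob_space.expectation M (\<lambda>\<omega>. J \<omega> $ v) = q v) \<and>
     (\<forall>u v. {u, v} \<in> E \<longrightarrow> correlation M (\<lambda>\<omega>. J \<omega> $ u) (\<lambda>\<omega>. J \<omega> $ v) = \<alpha> {u, v})"

text \<open>The thinning of a count \<open>n\<close> by a realisation \<open>b\<close> of the Bernoulli sequence.\<close>

definition thinning :: "(nat \<Rightarrow> bool) \<Rightarrow> nat \<Rightarrow> nat" where
  "thinning b n = (\<Sum>i<n. of_bool (b i))"

text \<open>
  The vector determined by realisations \<open>l\<close> of the Poisson variables and \<open>b\<close> of the Bernoulli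
  sequences; on a tree the recursion has exactly one solution.
\<close>

definition mpmrf_solution ::
  "'v set set \<Rightarrow> 'v \<Rightarrow> ('v \<Rightarrow> nat) \<Rightarrow> ('v \<Rightarrow> nat \<Rightarrow> bool) \<Rightarrow> 'v \<Rightarrow> nat" where
  "mpmrf_solution E r l b =
     (THE n. n r = l r \<and> (\<forall>v\<in>dsc r. n v = thinning (b v) (n (pa E r v)) + l v))"

definition poisson_innovations ::
  "real \<Rightarrow> ('v set \<Rightarrow> real) \<Rightarrow> 'v set set \<Rightarrow> 'v \<Rightarrow> ('v \<Rightarrow> nat) measure" where
  "poisson_innovations lam \<alpha> E r =
     (\<Pi>\<^sub>M v\<in>UNIV. measure_pmf
        (poisson_pmf (if v = r then lam else lam * (1 - \<alpha> {pa E r v, v}))))"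

definition bernoulli_sequences ::
  "('v set \<Rightarrow> real) \<Rightarrow> 'v set set \<Rightarrow> 'v \<Rightarrow> ('v \<Rightarrow> nat \<Rightarrow> bool) measure" where
  "bernoulli_sequences \<alpha> E r =
     (\<Pi>\<^sub>M v\<in>dsc r. \<Pi>\<^sub>M i\<in>UNIV. measure_pmf (bernoulli_pmf (\<alpha> {pa E r v, v})))"

definition MPMRF ::
  "real \<Rightarrow> ('v::finite set \<Rightarrow> real) \<Rightarrow> 'v set set \<Rightarrow> 'v \<Rightarrow> (real ^ 'v) measure" where
  "MPMRF lam \<alpha> E r =
     distr (poisson_innovations lam \<alpha> E r \<Otimes>\<^sub>M bernoulli_sequences \<alpha> E r) borel
       (\<lambda>(l, b). \<chi> v. real (mpmrf_solution E r l b v))"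

definition is_MPMRF ::
  "'a measure \<Rightarrow> ('a \<Rightarrow> real ^ 'v::finite) \<Rightarrow> real \<Rightarrow> ('v set \<Rightarrow> real) \<Rightarrow> 'v set set \<Rightarrow> bool" where
  "is_MPMRF M N lam \<alpha> E \<longleftrightarrow>
     prob_space M \<and> N \<in> borel_measurable M \<and> (\<exists>r. distr M borel N = MPMRF lam \<alpha> E r)"

end

theory Submission
  imports Defs
begin

text \<open>
  Root the tree at the vertex \<open>r\<close> from which the Poisson field is built. Both laws then are Markov
  chains on the rooted tree. For the Poisson field, the probability of a binary vector is bounded
  below by a product over the vertices of transition masses (\<open>MPMRF_binary_lower_bound\<close>), each of
  which is a Bernoulli thinning of the parent convolved with a Poisson law. For the Ising model, the
  exponential form says that its mass function is a product of positive functions of the values at a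
  vertex and at its parent (\<open>ising_tree_weight\<close>), and the means and edge correlations determine the
  law of every pair formed by a vertex and its parent (\<open>ising_weights\<close>).

  Because \<open>J\<close> is binary, the total variation distance is at most the sum over binary vectors of the
  positive part of \<open>P(J = x) - P(N = x)\<close> (\<open>d_TV_le_if_binary\<close>). In \<open>tree_weight_hybrid\<close> this sum is
  bounded by replacing the transitions one at a time, from the leaves towards the root: each
  replacement costs the one-step discrepancy between the two transitions, averaged over the
  \<^emph>\<open>Ising\<close> law of the parent. So only the pair laws of \<open>J\<close> enter, although the Ising model is not
  given by transition probabilities.

  It remains to evaluate the cost of a vertex. At the root the Bernoulli law of mean \<open>q\<close> is compared
  with the Poisson law of mean \<open>q\<close>, which costs exactly \<open>q (1 - exp (- q))\<close>. At any other vertex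
  the cost is \<open>q (1 - exp (- q (1 - a)) (1 - q a (1 - a)))\<close> with \<open>a\<close> the edge correlation, and this
  does not exceed the cost of the root (\<open>mpmrf_ising_edge_bound\<close>). Summing over the \<open>d\<close> vertices gives
  the bound, and the limit follows by squeezing.
\<close>

section \<open>Rooted trees\<close>

text \<open>
  Two paths from \<open>v\<close> that leave \<open>v\<close> through different neighbours must meet again, at the latest in
  \<open>r\<close>. Cutting the first path at its first common vertex with the second one, and returning along the
  second one, gives a cycle through \<open>v\<close>.
\<close>

lemma path_step_unique:
  assumes nc: "\<nexists>c. is_cycle E c"
    and p: "is_path E v (v # p) r" and p': "is_path E v (v # p') r"
    and ne: "p \<noteq> []" "p' \<noteq> []"
  shows "hd p = hd p'"
proof (rule ccontr)
  assume neq: "hd p \<noteq> hd p'"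
  have "last p = r" "last p' = r" using p p' ne by (auto simp: is_path_def)
  then have "\<exists>x\<in>set p. x \<in> set p'" using ne by (metis last_in_set)
  then obtain p1 x p2 where p1: "p = p1 @ x # p2" "x \<in> set p'" "\<forall>y\<in>set p1. y \<notin> set p'"
    using split_list_first_prop[of p "\<lambda>x. x \<in> set p'"] by blast
  then obtain p1' p2' where p1': "p' = p1' @ x # p2'" using split_list by metis
  have d: "distinct (v # p1 @ x # p2)" "distinct (v # p1' @ x # p2')"
    and s: "successively (\<lambda>a b. {a, b} \<in> E) (v # p1 @ x # p2)"
           "successively (\<lambda>a b. {a, b} \<in> E) (v # p1' @ x # p2')"
    using p p' p1(1) p1' by (auto simp: is_path_def)
  have "3 \<le> length (v # p1 @ x # rev p1')"
    using neq p1 p1' by (cases p1; cases p1') auto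
  moreover have "distinct (v # p1 @ x # rev p1')" using d p1 p1' by auto
  moreover have "successively (\<lambda>a b. {a, b} \<in> E) (v # p1 @ x # rev p1')"
  proof -
    have 1: "successively (\<lambda>a b. {a, b} \<in> E) ((v # p1) @ [x])"
      using s(1) successively_append_iff[of _ "(v # p1) @ [x]" p2] by simp
    have "successively (\<lambda>a b. {a, b} \<in> E) (p1' @ [x])"
      using s(2) successively_append_iff[of _ "p1' @ [x]" p2'] by (auto simp: successively_Cons)
    then have "successively (\<lambda>a b. {a, b} \<in> E) (rev (p1' @ [x]))"
      by (subst successively_rev) (simp add: insert_commute)
    then have "successively (\<lambda>a b. {a, b} \<in> E) (x # rev p1')" by simp
    with 1 show ?thesis
      using successively_append_iff[of "(\<lambda>a b. {a, b} \<in> E)" "v # p1" "x # rev p1'"] 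
        successively_append_iff[of "(\<lambda>a b. {a, b} \<in> E)" "v # p1" "[x]"] by simp
  qed
  moreover have "{last (v # p1 @ x # rev p1'), v} \<in> E"
    using s(2) by (cases p1') (auto simp: successively_Cons insert_commute)
  ultimately have "is_cycle E (v # p1 @ x # rev p1')" by (simp only: is_cycle_def list.sel)
  with nc show False by blast
qed

lemma is_path_Cons_Cons:
  "is_path E v (v # u # p) r \<longleftrightarrow> {v, u} \<in> E \<and> v \<notin> set (u # p) \<and> is_path E u (u # p) r"
  by (auto simp: is_path_def)

lemma is_path_cases:
  assumes "is_path E v p r"
  obtains "v = r" "p = [v]" | u p' where "v \<noteq> r" "p = v # u # p'"
proof (cases p)
  case Nil
  with assms show ?thesis by (simp add: is_path_def)
next
  case (Cons a l)
  then have "a = v" using assms by (simp add: is_path_def)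
  show ?thesis
  proof (cases l)
    case Nil
    with Cons \<open>a = v\<close> assms show ?thesis by (intro that(1)) (auto simp: is_path_def)
  next
    case (Cons u p')
    have "r \<in> set l" using \<open>p = a # l\<close> Cons assms last_in_set[of l] by (auto simp: is_path_def)
    then have "v \<noteq> r" using \<open>p = a # l\<close> assms by (auto simp: is_path_def)
    with Cons \<open>p = a # l\<close> \<open>a = v\<close> show ?thesis by (intro that(2)) auto
  qed
qed

lemma path_unique:
  assumes nc: "\<nexists>c. is_cycle E c"
    and p: "is_path E v p r" and p': "is_path E v p' r"
  shows "p = p'"
  using p p'
proof (induction p arbitrary: v p')
  case Nil
  then show ?case by (simp add: is_path_def)
next
  case (Cons a p)
  from Cons.prems(1) show ?case
  proof (cases rule: is_path_cases)
    case 1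
    with Cons.prems(2) show ?thesis by (auto elim: is_path_cases)
  next
    case (2 u l)
    then obtain u' l' where p': "p' = v # u' # l'"
      using Cons.prems(2) by (auto elim: is_path_cases)
    have "u = u'"
      using path_step_unique[OF nc, of v "u # l" r "u' # l'"] Cons.prems 2 p' by simp
    then show ?thesis
      using Cons.IH[of u "u # l'"] Cons.prems 2 p' by (auto simp: is_path_Cons_Cons)
  qed
qed

lemma pa_eqI:
  assumes nc: "\<nexists>c. is_cycle E c" and p: "is_path E v (v # u # p) r"
  shows "pa E r v = u"
  unfolding pa_def using p path_unique[OF nc p] by (intro the_equality) auto

text \<open>
  The edges of a rooted tree correspond bijectively to the vertices other than the root. For an edge
  \<open>{u, w}\<close>, take the path from \<open>u\<close> to \<open>r\<close>: if it visits \<open>w\<close>, then the edge followed by the tail of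
  the path starting in \<open>w\<close> is a path, so \<open>w\<close> is the parent of \<open>u\<close>; otherwise the path extends to
  one from \<open>w\<close>, and \<open>u\<close> is the parent of \<open>w\<close>. The depth of a vertex, the length of its path to the
  root, makes the parent map well-founded.
\<close>

lemma tree_rooted:
  fixes E :: "'v::finite set set"
  assumes tree: "is_tree E"
  obtains depth :: "'v \<Rightarrow> nat" where
    "\<And>v. v \<noteq> r \<Longrightarrow> depth (pa E r v) < depth v"
    "E = (\<lambda>v. {pa E r v, v}) ` dsc r"
    "inj_on (\<lambda>v. {pa E r v, v}) (dsc r)"
proof -
  have nc: "\<nexists>c. is_cycle E c" and ex: "\<exists>p. is_path E u p w" and e2: "e \<in> E \<Longrightarrow> card e = 2"
    for u w e using tree by (auto simp: is_tree_def)
  define path where "path v = (SOME p. is_path E v p r)" for v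
  have path: "is_path E v (path v) r" for v unfolding path_def using ex by (rule someI_ex)
  define depth where "depth v = length (path v)" for v
  have len: "depth v = length p" if "is_path E v p r" for v p
    using path_unique[OF nc path that] by (simp add: depth_def)
  have step: "depth (pa E r v) < depth v \<and> {pa E r v, v} \<in> E" if "v \<noteq> r" for v
  proof -
    from path[of v] that obtain u p where p: "is_path E v (v # u # p) r"
      by (metis is_path_cases)
    with pa_eqI[OF nc p] len[OF p] len[of u "u # p"] show ?thesis
      by (simp add: is_path_Cons_Cons insert_commute)
  qed
  have "E \<subseteq> (\<lambda>v. {pa E r v, v}) ` dsc r"
  proof
    fix e assume e: "e \<in> E"
    then obtain u w where uw: "e = {u, w}" "u \<noteq> w" by (meson e2 card_2_iff)
    obtain p where p: "is_path E u p r" using ex by blast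
    have "(pa E r w = u \<and> w \<noteq> r) \<or> (pa E r u = w \<and> u \<noteq> r)"
    proof (cases "w \<in> set p")
      case False
      from p obtain l where l: "p = u # l" by (auto elim: is_path_cases)
      then have "is_path E w (w # u # l) r"
        using p False e uw by (simp add: is_path_Cons_Cons insert_commute)
      moreover have "w \<noteq> r" using p False by (auto simp: is_path_def)
      ultimately show ?thesis using pa_eqI[OF nc] by blast
    next
      case True
      with p uw obtain l where l: "p = u # l" "w \<in> set l" by (auto elim: is_path_cases)
      then obtain l1 l2 where l2: "l = l1 @ w # l2" by (meson split_list)
      have "is_path E w (w # l2) r"
        using p l l2 successively_append_iff[of "(\<lambda>a b. {a, b} \<in> E)" "u # l1" "w # l2"]
        by (auto simp: is_path_def)
      then have "is_path E u (u # w # l2) r"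
        using p l l2 e uw by (auto simp: is_path_Cons_Cons is_path_def)
      moreover have "u \<noteq> r" using p l by (auto simp: is_path_def split: if_splits)
      ultimately show ?thesis using pa_eqI[OF nc] by blast
    qed
    then show "e \<in> (\<lambda>v. {pa E r v, v}) ` dsc r"
      using uw by (auto simp: dsc_def insert_commute)
  qed
  moreover have "inj_on (\<lambda>v. {pa E r v, v}) (dsc r)"
  proof (rule inj_onI)
    fix x y assume "x \<in> dsc r" "y \<in> dsc r" "{pa E r x, x} = {pa E r y, y}"
    moreover from this have "depth (pa E r x) < depth x" "depth (pa E r y) < depth y"
      using step by (auto simp: dsc_def)
    ultimately show "x = y" by (auto simp: doubleton_eq_iff)
  qed
  ultimately show ?thesis using that[of depth] step by (auto simp: dsc_def)
qed

section \<open>Replacing the transitions of a Markov weight on a tree\<close>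

lemma sum_Pow_insert:
  fixes f :: "'v set \<Rightarrow> 'b::comm_monoid_add"
  assumes "finite S" "v \<notin> S"
  shows "(\<Sum>A\<in>Pow (insert v S). f A) = (\<Sum>A\<in>Pow S. f A + f (insert v A))"
proof -
  have "inj_on (insert v) (Pow S)"
    using assms(2) by (auto simp: inj_on_def)
  moreover have "Pow S \<inter> insert v ` Pow S = {}" using assms(2) by auto
  ultimately show ?thesis
    using assms by (simp add: Pow_insert sum.union_disjoint sum.reindex sum.distrib)
qed

text \<open>
  A binary vector indexed by \<open>S\<close> is represented by the set \<open>A \<subseteq> S\<close> of its ones, so that sums over
  configurations are sums over \<open>Pow S\<close> and adding a vertex splits them by \<open>sum_Pow_insert\<close>. The
  factor of \<open>v\<close> takes the value at \<open>v\<close> first and the value at the parent second.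
\<close>

definition tree_weight ::
  "('v \<Rightarrow> 'v) \<Rightarrow> ('v \<Rightarrow> bool \<Rightarrow> bool \<Rightarrow> real) \<Rightarrow> 'v set \<Rightarrow> 'v set \<Rightarrow> real" where
  "tree_weight pr \<phi> S A = (\<Prod>v\<in>S. \<phi> v (v \<in> A) (pr v \<in> A))"

definition marginal :: "'v set \<Rightarrow> ('v set \<Rightarrow> real) \<Rightarrow> 'v \<Rightarrow> bool \<Rightarrow> real" where
  "marginal S w v a = (\<Sum>A\<in>Pow S. of_bool ((v \<in> A) = a) * w A)"

definition pair_marginal :: "'v set \<Rightarrow> ('v set \<Rightarrow> real) \<Rightarrow> 'v \<Rightarrow> 'v \<Rightarrow> bool \<Rightarrow> bool \<Rightarrow> real" where
  "pair_marginal S w v u a b = (\<Sum>A\<in>Pow S. of_bool ((v \<in> A) = a \<and> (u \<in> A) = b) * w A)"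

definition root_defect :: "'v set \<Rightarrow> ('v set \<Rightarrow> real) \<Rightarrow> (bool \<Rightarrow> real) \<Rightarrow> 'v \<Rightarrow> real" where
  "root_defect S w k r = (\<Sum>a\<in>UNIV. max 0 (marginal S w r a - k a))"

text \<open>
  The discrepancy between the transition of \<open>w\<close> from \<open>u\<close> to \<open>v\<close> and a kernel \<open>k\<close>, averaged over the
  value at \<open>u\<close> under \<open>w\<close>. Working with the joint mass instead of the conditional one avoids dividing
  by the marginal.
\<close>

definition edge_defect ::
  "'v set \<Rightarrow> ('v set \<Rightarrow> real) \<Rightarrow> (bool \<Rightarrow> bool \<Rightarrow> real) \<Rightarrow> 'v \<Rightarrow> 'v \<Rightarrow> real" where
  "edge_defect S w k v u =
     (\<Sum>a\<in>UNIV. \<Sum>b\<in>UNIV. max 0 (pair_marginal S w v u a b - marginal S w u b * k a b))"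

lemma sum_Pow_split:
  assumes "finite S"
  shows "(\<Sum>A\<in>Pow S. h A) = (\<Sum>b\<in>UNIV. \<Sum>A\<in>Pow S. of_bool ((u \<in> A) = b) * (h A :: real))"
  by (simp add: UNIV_bool flip: sum.distrib) (intro sum.cong; auto)

lemma tree_weight_insert:
  assumes "finite S" "v \<notin> S" "\<And>u. u \<in> S \<Longrightarrow> pr u \<noteq> v" "pr v \<noteq> v" "A \<subseteq> S"
  shows "tree_weight pr \<phi> (insert v S) A = tree_weight pr \<phi> S A * \<phi> v False (pr v \<in> A)"
    and "tree_weight pr \<phi> (insert v S) (insert v A) = tree_weight pr \<phi> S A * \<phi> v True (pr v \<in> A)"
proof -
  have "v \<notin> A" using assms by auto
  moreover have "(\<Prod>u\<in>S. \<phi> u (u \<in> insert v A) (pr u \<in> insert v A)) = tree_weight pr \<phi> S A"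
    unfolding tree_weight_def
  proof (rule prod.cong[OF refl])
    fix u assume "u \<in> S"
    then have "u \<noteq> v" "pr u \<noteq> v" using assms(2,3) by auto
    then show "\<phi> u (u \<in> insert v A) (pr u \<in> insert v A) = \<phi> u (u \<in> A) (pr u \<in> A)" by simp
  qed
  ultimately show "tree_weight pr \<phi> (insert v S) A = tree_weight pr \<phi> S A * \<phi> v False (pr v \<in> A)"
    and "tree_weight pr \<phi> (insert v S) (insert v A) = tree_weight pr \<phi> S A * \<phi> v True (pr v \<in> A)"
    using assms by (auto simp: tree_weight_def)
qed

lemma tree_weight_pos:
  "(\<And>v a b. 0 < \<phi> v a b) \<Longrightarrow> 0 < tree_weight pr \<phi> S A"
  unfolding tree_weight_def by (intro prod_pos) auto

text \<open>
  One replacement step: \<open>w k\<close> is compared with \<open>n l\<close> through the hybrid product \<open>w l\<close>.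
\<close>

lemma max_product_le:
  fixes w k l n :: real
  assumes "0 \<le> w" "0 \<le> l"
  shows "max 0 (w * k - n * l) \<le> max 0 (w - n) * l + max 0 (w * k - w * l)"
proof -
  have "w * k - n * l = (w - n) * l + (w * k - w * l)" by (simp add: algebra_simps)
  also have "\<dots> \<le> max 0 (w - n) * l + max 0 (w * k - w * l)"
    using assms(2) by (intro add_mono mult_right_mono) auto
  finally show ?thesis using assms by simp
qed

text \<open>
  Vertices are added in order of depth, so the last one, \<open>v\<close>, is a leaf. Summing its factor out of the
  weight gives a weight of the same form on the remaining vertices, where the factor of the parent has
  absorbed the sum \<open>s\<close>; this leaves all marginals on the remaining vertices unchanged. The original
  weight is the smaller one times the transition \<open>\<kappa>\<close>, and replacing \<open>\<kappa>\<close> by the kernel \<open>K v\<close> costs the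
  edge defect of \<open>v\<close>. The error made on the smaller tree is then multiplied by \<open>K v\<close>, whose total mass
  is at most one. The factors \<open>\<phi>\<close> vary in the induction because the absorption changes them.
\<close>

lemma tree_weight_hybrid:
  fixes depth :: "'v \<Rightarrow> nat" and \<phi> K :: "'v \<Rightarrow> bool \<Rightarrow> bool \<Rightarrow> real"
  assumes "finite S" and "r \<notin> S" and "\<And>v. v \<in> S \<Longrightarrow> pr v \<in> insert r S" and "pr r = r"
    and depth: "\<And>v. v \<noteq> r \<Longrightarrow> depth (pr v) < depth v"
    and "\<And>v a b. 0 < \<phi> v a b"
    and K0: "\<And>v a b. 0 \<le> K v a b"
    and K1: "\<And>v b. v \<noteq> r \<Longrightarrow> K v False b + K v True b \<le> 1"
  defines "w \<equiv> tree_weight pr \<phi> (insert r S)"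
  shows "(\<Sum>A\<in>Pow (insert r S). max 0 (w A - tree_weight pr K (insert r S) A))
    \<le> root_defect (insert r S) w (\<lambda>a. K r a a) r
       + (\<Sum>v\<in>S. edge_defect (insert r S) w (K v) v (pr v))"
  using assms(1-3,6) unfolding w_def
proof (induction S arbitrary: \<phi> rule: finite_ranking_induct[where f = depth])
  case empty
  then show ?case
    using \<open>pr r = r\<close> by (simp add: root_defect_def marginal_def tree_weight_def Pow_insert UNIV_bool)
next
  case (insert v S)
  show ?case
  proof (cases "v \<in> S")
    case True
    then show ?thesis using insert by (simp add: insert_absorb)
  next
    case False
    let ?S = "insert r S" and ?u = "pr v"
    have fin: "finite ?S" and vr: "v \<noteq> r" and v: "v \<notin> ?S"
      using insert False by auto
    have leaf: "pr x \<noteq> v" if "x \<in> ?S" for x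
      using that vr depth[of x] insert.hyps(2)[of x] \<open>pr r = r\<close> by (cases "x = r") force+
    have uv: "?u \<noteq> v" using depth[OF vr] by auto
    have u: "?u \<in> ?S" using insert.prems uv by blast
    have closed: "pr x \<in> ?S" if "x \<in> S" for x
      using insert.prems(2)[of x] leaf[of x] that by auto
    \<comment> \<open>The weight \<open>w\<close> ignores the leaf, \<open>w'\<close> includes it, and \<open>w''\<close> is the marginal of \<open>w'\<close> away from it.\<close>
    define s where "s b = \<phi> v False b + \<phi> v True b" for b
    have s: "0 < s b" for b using insert.prems(3) by (simp add: s_def add_pos_pos)
    define \<phi>' where "\<phi>' = \<phi>(?u := \<lambda>a b. \<phi> ?u a b * s a)"
    have \<phi>': "0 < \<phi>' x a b" for x a b using insert.prems(3) s by (simp add: \<phi>'_def)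
    define w where "w = tree_weight pr \<phi> ?S"
    define w' where "w' = tree_weight pr \<phi> (insert v ?S)"
    define w'' where "w'' = tree_weight pr \<phi>' ?S"
    define T where "T = tree_weight pr K ?S"
    define T' where "T' = tree_weight pr K (insert v ?S)"
    have w'': "w'' A = w A * s (?u \<in> A)" for A
      unfolding w''_def w_def tree_weight_def \<phi>'_def using fin u
      by (simp add: prod.remove[of ?S ?u] mult.assoc mult.left_commute)
    have w''0: "0 \<le> w'' A" for A unfolding w''_def using tree_weight_pos[of \<phi>'] \<phi>' by (simp add: less_imp_le)
    have w': "w' A = w A * \<phi> v False (?u \<in> A)" "w' (insert v A) = w A * \<phi> v True (?u \<in> A)"
      if "A \<in> Pow ?S" for A
      unfolding w'_def w_def using that by (intro tree_weight_insert fin v leaf uv; auto)+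
    have T': "T' A = T A * K v False (?u \<in> A)" "T' (insert v A) = T A * K v True (?u \<in> A)"
      if "A \<in> Pow ?S" for A
      unfolding T'_def T_def using that by (intro tree_weight_insert fin v leaf uv; auto)+
    have w'_sum: "w' A + w' (insert v A) = w'' A" if "A \<in> Pow ?S" for A
      using w'[OF that] by (simp add: w'' s_def algebra_simps)
    have sum_split: "(\<Sum>A\<in>Pow (insert v ?S). f A) = (\<Sum>A\<in>Pow ?S. f A + f (insert v A))"
      for f :: "'v set \<Rightarrow> real" by (rule sum_Pow_insert[OF fin v])
    have one: "marginal (insert v ?S) w' x a = marginal ?S w'' x a" if "x \<in> ?S" for x a
      using that v unfolding marginal_def sum_split
      by (intro sum.cong) (auto simp: algebra_simps simp flip: w'_sum)
    have two: "pair_marginal (insert v ?S) w' x y a b = pair_marginal ?S w'' x y a b"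
      if "x \<in> ?S" "y \<in> ?S" for x y a b
      using that v unfolding pair_marginal_def sum_split
      by (intro sum.cong) (auto simp: algebra_simps simp flip: w'_sum)
    define m where "m b = marginal ?S w ?u b" for b
    have one_u: "marginal (insert v ?S) w' ?u b = m b * s b" for b
    proof -
      have "marginal ?S w'' ?u b = m b * s b"
        unfolding m_def marginal_def sum_distrib_right by (intro sum.cong) (cases b; auto simp: w'')+
      then show ?thesis by (simp only: one[OF u])
    qed
    have two_u: "pair_marginal (insert v ?S) w' v ?u a b = m b * \<phi> v a b" for a b
      using v uv unfolding pair_marginal_def sum_split m_def marginal_def sum_distrib_right
      by (intro sum.cong) (cases b; cases a; auto simp: w')+
    have m0: "0 \<le> m b" for b
      unfolding m_def marginal_def w_def using tree_weight_pos[of \<phi>] insert.prems(3)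
      by (intro sum_nonneg) (auto simp: less_imp_le)
    define \<kappa> where "\<kappa> a b = \<phi> v a b / s b" for a b
    have \<kappa>: "w A * \<phi> v a (?u \<in> A) = w'' A * \<kappa> a (?u \<in> A)" for A a
      using s[of "?u \<in> A"] by (simp add: w'' \<kappa>_def)
    define D where "D b = (\<Sum>a\<in>UNIV. max 0 (\<kappa> a b - K v a b))" for b
    have pointwise: "max 0 (w' A - T' A) + max 0 (w' (insert v A) - T' (insert v A))
        \<le> max 0 (w'' A - T A) + w'' A * D (?u \<in> A)" if A: "A \<in> Pow ?S" for A
    proof -
      let ?b = "?u \<in> A"
      have "max 0 (w' A - T' A) + max 0 (w' (insert v A) - T' (insert v A))
        = (\<Sum>a\<in>UNIV. max 0 (w'' A * \<kappa> a ?b - T A * K v a ?b))"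
        using w'[OF A] T'[OF A] \<kappa> by (simp add: UNIV_bool)
      also have "\<dots> \<le> (\<Sum>a\<in>UNIV. max 0 (w'' A - T A) * K v a ?b + max 0 (w'' A * \<kappa> a ?b - w'' A * K v a ?b))"
        by (intro sum_mono max_product_le w''0 K0)
      also have "\<dots> = max 0 (w'' A - T A) * (K v False ?b + K v True ?b) + w'' A * D ?b"
        using w''0[of A]
        by (simp add: UNIV_bool D_def algebra_simps max_mult_distrib_left)
      also have "\<dots> \<le> max 0 (w'' A - T A) * 1 + w'' A * D ?b"
        by (intro add_right_mono mult_left_mono K1 vr) auto
      finally show ?thesis by simp
    qed
    have "(\<Sum>A\<in>Pow ?S. w'' A * D (?u \<in> A)) = (\<Sum>b\<in>UNIV. m b * s b * D b)"
    proof -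
      have "(\<Sum>A\<in>Pow ?S. of_bool ((?u \<in> A) = b) * (w'' A * D (?u \<in> A))) = m b * s b * D b" for b
        unfolding one_u[symmetric] one[OF u] by (cases b) (auto simp: marginal_def sum_distrib_right intro!: sum.cong)
      then show ?thesis by (subst sum_Pow_split[OF fin, of _ ?u]) simp
    qed
    also have "\<dots> = edge_defect (insert v ?S) w' (K v) v ?u"
    proof -
      have "m b * s b * max 0 (\<kappa> a b - K v a b) = max 0 (m b * \<phi> v a b - m b * s b * K v a b)" for a b
        using m0[of b] s[of b] by (simp add: max_mult_distrib_left \<kappa>_def right_diff_distrib)
      then show ?thesis
        unfolding edge_defect_def one_u two_u D_def sum_distrib_left
        by (subst sum.swap) (simp add: mult.assoc)
    qed
    finally have edge: "(\<Sum>A\<in>Pow ?S. w'' A * D (?u \<in> A)) = edge_defect (insert v ?S) w' (K v) v ?u" .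
    have "(\<Sum>A\<in>Pow (insert v ?S). max 0 (w' A - T' A))
      \<le> (\<Sum>A\<in>Pow ?S. max 0 (w'' A - T A) + w'' A * D (?u \<in> A))"
      unfolding sum_split by (intro sum_mono pointwise)
    also have "\<dots> = (\<Sum>A\<in>Pow ?S. max 0 (w'' A - T A)) + edge_defect (insert v ?S) w' (K v) v ?u"
      by (simp add: sum.distrib edge)
    also have "(\<Sum>A\<in>Pow ?S. max 0 (w'' A - T A)) \<le> root_defect ?S w'' (\<lambda>a. K r a a) r
       + (\<Sum>x\<in>S. edge_defect ?S w'' (K x) x (pr x))"
      unfolding w''_def T_def using insert.prems closed \<phi>' by (intro insert.IH) auto
    also have "root_defect ?S w'' (\<lambda>a. K r a a) r = root_defect (insert v ?S) w' (\<lambda>a. K r a a) r"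
      by (simp add: root_defect_def one)
    also have "(\<Sum>x\<in>S. edge_defect ?S w'' (K x) x (pr x)) = (\<Sum>x\<in>S. edge_defect (insert v ?S) w' (K x) x (pr x))"
      using closed by (intro sum.cong) (auto simp: edge_defect_def one two)
    finally show ?thesis
      using False insert.hyps(1) unfolding w'_def T'_def
      by (simp add: insert_commute[of r v] algebra_simps)
  qed
qed

section \<open>Laws concentrated on binary vectors\<close>

definition indicator_vector :: "'v set \<Rightarrow> real ^ 'v" where
  "indicator_vector A = (\<chi> v. of_bool (v \<in> A))"

lemma indicator_vector_eq_iff [simp]: "indicator_vector A = indicator_vector B \<longleftrightarrow> A = B"
  by (auto simp: indicator_vector_def vec_eq_iff)

lemma bij_indicator_vector: "bij_betw indicator_vector (UNIV :: 'v::finite set set) binary_vectors"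
proof (rule bij_betw_byWitness[where f' = "\<lambda>x. {v. x $ v = 1}"])
  show "\<forall>a'\<in>(binary_vectors :: (real ^ 'v) set). indicator_vector {v. a' $ v = 1} = a'"
  proof
    fix a' :: "real ^ 'v" assume "a' \<in> binary_vectors"
    then have "a' $ v = 0 \<or> a' $ v = 1" for v by (auto simp: binary_vectors_def)
    then show "indicator_vector {v. a' $ v = 1} = a'"
      by (auto simp: indicator_vector_def vec_eq_iff)
  qed
qed (auto simp: indicator_vector_def binary_vectors_def)

lemma expectation_binary:
  fixes J :: "'a \<Rightarrow> real ^ 'v::finite" and f :: "real ^ 'v \<Rightarrow> real"
  assumes "prob_space M" and J: "J \<in> borel_measurable M" and bin: "AE \<omega> in M. J \<omega> \<in> binary_vectors"
    and f: "f \<in> borel_measurable borel"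
  shows "prob_space.expectation M (\<lambda>\<omega>. f (J \<omega>))
    = (\<Sum>A\<in>UNIV. f (indicator_vector A) * \<P>(\<omega> in M. J \<omega> = indicator_vector A))"
proof -
  interpret prob_space M by fact
  note [measurable] = J f
  let ?E = "\<lambda>A. {\<omega> \<in> space M. J \<omega> = indicator_vector A}"
  have E: "?E A \<in> sets M" for A by measurable
  have "AE \<omega> in M. f (J \<omega>) = (\<Sum>A\<in>UNIV. f (indicator_vector A) * indicator (?E A) \<omega>)"
    using bin
  proof (rule AE_mp, intro AE_I2 impI)
    fix \<omega> assume "\<omega> \<in> space M" "J \<omega> \<in> binary_vectors"
    then obtain B where B: "J \<omega> = indicator_vector B"
      using bij_indicator_vector by (metis bij_betw_iff_bijections)
    have "(\<Sum>A\<in>UNIV. f (indicator_vector A) * indicator (?E A) \<omega>)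
      = (\<Sum>A\<in>UNIV. if A = B then f (indicator_vector A) else 0)"
      using \<open>\<omega> \<in> space M\<close> B
      by (intro sum.cong) (auto simp: indicator_def)
    then show "f (J \<omega>) = (\<Sum>A\<in>UNIV. f (indicator_vector A) * indicator (?E A) \<omega>)"
      by (simp add: B)
  qed
  then have "expectation (\<lambda>\<omega>. f (J \<omega>))
      = expectation (\<lambda>\<omega>. \<Sum>A\<in>UNIV. f (indicator_vector A) * indicator (?E A) \<omega>)"
    by (intro integral_cong_AE borel_measurable_sum borel_measurable_times borel_measurable_indicator E)
      measurable
  also have "\<dots> = (\<Sum>A\<in>UNIV. f (indicator_vector A) * prob (?E A))"
    using E by (subst Bochner_Integration.integral_sum)
      (auto intro!: integrable_mult_right simp: emeasure_eq_measure less_top[symmetric])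
  finally show ?thesis .
qed

text \<open>
  Since \<open>J\<close> charges only binary vectors, an event has \<open>J\<close>-probability exceeding its \<open>N\<close>-probability by at
  most the excess collected on the binary vectors it contains. Applying this to the complement of the
  event bounds the difference in the other direction.
\<close>

lemma d_TV_le_if_binary:
  fixes N :: "'a \<Rightarrow> real ^ 'v::finite" and J :: "'b \<Rightarrow> real ^ 'v"
  assumes "prob_space M" "prob_space M'" and N: "N \<in> borel_measurable M" and J: "J \<in> borel_measurable M'"
    and bin: "AE \<omega> in M'. J \<omega> \<in> binary_vectors"
  shows "d_TV M N M' J \<le> (\<Sum>A\<in>UNIV. max 0 (\<P>(\<omega> in M'. J \<omega> = indicator_vector A) - \<P>(\<omega> in M. N \<omega> = indicator_vector A)))"
    (is "_ \<le> ?R")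
proof -
  interpret M: prob_space M by fact
  interpret M': prob_space M' by fact
  note [measurable] = N J
  let ?p = "\<lambda>A. \<P>(\<omega> in M'. J \<omega> = indicator_vector A)" and ?n = "\<lambda>A. \<P>(\<omega> in M. N \<omega> = indicator_vector A)"
  have half: "\<P>(\<omega> in M'. J \<omega> \<in> B) - \<P>(\<omega> in M. N \<omega> \<in> B) \<le> ?R" if [measurable]: "B \<in> sets borel" for B
  proof -
    let ?I = "{A. indicator_vector A \<in> B}"
    have "\<P>(\<omega> in M'. J \<omega> \<in> B) = M'.expectation (\<lambda>\<omega>. indicator B (J \<omega>))"
      by (subst Bochner_Integration.integral_cong[OF refl, of _ _ "indicator {\<omega>\<in>space M'. J \<omega> \<in> B}"])
        (auto simp: indicator_def)
    also have "\<dots> = (\<Sum>A\<in>UNIV. indicator B (indicator_vector A) * ?p A)"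
      by (intro expectation_binary bin M'.prob_space_axioms J) auto
    also have "\<dots> = (\<Sum>A\<in>?I. ?p A)"
      by (intro sum.mono_neutral_cong_right) (auto simp: indicator_def)
    finally have J_eq: "\<P>(\<omega> in M'. J \<omega> \<in> B) = (\<Sum>A\<in>?I. ?p A)" .
    have "(\<Sum>A\<in>?I. ?n A) = M.prob (\<Union>A\<in>?I. {\<omega>\<in>space M. N \<omega> = indicator_vector A})"
      by (intro M.finite_measure_finite_Union[symmetric]) (auto simp: disjoint_family_on_def)
    also have "\<dots> \<le> \<P>(\<omega> in M. N \<omega> \<in> B)" by (intro M.finite_measure_mono) auto
    finally have "\<P>(\<omega> in M'. J \<omega> \<in> B) - \<P>(\<omega> in M. N \<omega> \<in> B) \<le> (\<Sum>A\<in>?I. ?p A - ?n A)"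
      by (simp add: J_eq sum_subtractf)
    also have "\<dots> \<le> (\<Sum>A\<in>?I. max 0 (?p A - ?n A))" by (intro sum_mono) auto
    also have "\<dots> \<le> ?R" by (intro sum_mono2) auto
    finally show ?thesis .
  qed
  have "\<bar>\<P>(\<omega> in M. N \<omega> \<in> B) - \<P>(\<omega> in M'. J \<omega> \<in> B)\<bar> \<le> ?R" if [measurable]: "B \<in> sets borel" for B
  proof -
    have "{\<omega>\<in>space M. N \<omega> \<in> - B} = space M - {\<omega>\<in>space M. N \<omega> \<in> B}" by auto
    moreover have "{\<omega>\<in>space M'. J \<omega> \<in> - B} = space M' - {\<omega>\<in>space M'. J \<omega> \<in> B}" by auto
    moreover have "- B \<in> sets borel" by measurable
    ultimately have "\<P>(\<omega> in M. N \<omega> \<in> B) - \<P>(\<omega> in M'. J \<omega> \<in> B) \<le> ?R"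
      using half[of "- B"] by (simp add: M.prob_compl M'.prob_compl)
    with half[OF that] show ?thesis by linarith
  qed
  then show ?thesis unfolding d_TV_def by (intro cSUP_least) (auto intro: sets.empty_sets)
qed

lemma d_TV_nonneg:
  fixes N :: "'a \<Rightarrow> 'c::topological_space" and J :: "'b \<Rightarrow> 'c"
  assumes "prob_space M" "prob_space M'"
  shows "0 \<le> d_TV M N M' J"
proof -
  interpret M: prob_space M by fact
  interpret M': prob_space M' by fact
  have "\<bar>M.prob A - M'.prob B\<bar> \<le> 1" for A B
    using M.prob_le_1[of A] M'.prob_le_1[of B] measure_nonneg[of M A] measure_nonneg[of M' B] by linarith
  then show ?thesis unfolding d_TV_def
    by (intro cSUP_upper2[where x = "{}"] bdd_aboveI2[where M = 1]) auto
qed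

section \<open>The Ising model\<close>

text \<open>
  As the variances are \<open>q (1 - q)\<close>, the correlation along an edge is the covariance up to this factor,
  so it determines the probability that both ends are \<open>1\<close>.
\<close>

lemma ising_moments:
  fixes J :: "'a \<Rightarrow> real ^ 'v::finite"
  assumes ising: "is_tree_ising M J (\<lambda>_. q) \<alpha> E" and q: "0 < q" "q < 1"
    and w_def: "\<And>A. w A = \<P>(\<omega> in M. J \<omega> = indicator_vector A)"
  shows ising_total: "(\<Sum>A\<in>UNIV. w A) = 1"
    and ising_mean: "(\<Sum>A\<in>UNIV. of_bool (v \<in> A) * w A) = q"
    and ising_joint: "{u, v} \<in> E \<Longrightarrow> 
      (\<Sum>A\<in>UNIV. of_bool (u \<in> A) * of_bool (v \<in> A) * w A) = q\<^sup>2 + \<alpha> {u, v} * q * (1 - q)"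
proof -
  have M: "prob_space M" and J: "J \<in> borel_measurable M" and bin: "AE \<omega> in M. J \<omega> \<in> binary_vectors"
    and mean: "prob_space.expectation M (\<lambda>\<omega>. J \<omega> $ v) = q"
    and corr: "{u, v} \<in> E \<Longrightarrow> correlation M (\<lambda>\<omega>. J \<omega> $ u) (\<lambda>\<omega>. J \<omega> $ v) = \<alpha> {u, v}" for u v
    using ising by (auto simp: is_tree_ising_def)
  interpret prob_space M by (rule M)
  note E = expectation_binary[OF M J bin]
  have comp [measurable]: "(\<lambda>x. x $ v) \<in> borel_measurable (borel :: (real ^ 'v) measure)" for v
    by (intro borel_measurable_continuous_onI continuous_intros)
  have coord: "indicator_vector A $ v = of_bool (v \<in> A)" for A and v :: 'v
    by (simp add: indicator_vector_def)
  show total: "(\<Sum>A\<in>UNIV. w A) = 1" using E[of "\<lambda>_. 1"] by (simp add: w_def prob_space)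
  have first: "(\<Sum>A\<in>UNIV. of_bool (v \<in> A) * w A) = q" for v
    using E[of "\<lambda>x. x $ v"] mean[of v] by (simp add: w_def coord)
  then show "(\<Sum>A\<in>UNIV. of_bool (v \<in> A) * w A) = q" .
  have second: "expectation (\<lambda>\<omega>. (J \<omega> $ u - q) * (J \<omega> $ v - q))
      = (\<Sum>A\<in>UNIV. of_bool (u \<in> A) * of_bool (v \<in> A) * w A) - q\<^sup>2" for u v
  proof -
    have "expectation (\<lambda>\<omega>. (J \<omega> $ u - q) * (J \<omega> $ v - q))
      = (\<Sum>A\<in>UNIV. (of_bool (u \<in> A) - q) * (of_bool (v \<in> A) - q) * w A)"
      using E[of "\<lambda>x. (x $ u - q) * (x $ v - q)"] by (simp add: w_def coord)
    also have "\<dots> = (\<Sum>A\<in>UNIV. of_bool (u \<in> A) * of_bool (v \<in> A) * w A)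
      - q * (\<Sum>A\<in>UNIV. of_bool (u \<in> A) * w A) - q * (\<Sum>A\<in>UNIV. of_bool (v \<in> A) * w A)
      + q\<^sup>2 * (\<Sum>A\<in>UNIV. w A)"
      unfolding sum_distrib_left sum_subtractf[symmetric] sum.distrib[symmetric]
      by (intro sum.cong) (auto simp: algebra_simps power2_eq_square)
    finally show ?thesis by (simp add: first total power2_eq_square)
  qed
  have var: "variance (\<lambda>\<omega>. J \<omega> $ v) = q * (1 - q)" for v
  proof -
    have "(\<Sum>A\<in>UNIV. of_bool (v \<in> A) * of_bool (v \<in> A) * w A) = q"
      unfolding first[of v, symmetric] by (intro sum.cong) auto
    then show ?thesis using second[of v v] by (simp add: mean power2_eq_square algebra_simps)
  qed
  show "(\<Sum>A\<in>UNIV. of_bool (u \<in> A) * of_bool (v \<in> A) * w A) = q\<^sup>2 + \<alpha> {u, v} * q * (1 - q)"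
    if "{u, v} \<in> E"
  proof -
    have "q * (1 - q) > 0" using q by simp
    moreover have "((\<Sum>A\<in>UNIV. of_bool (u \<in> A) * of_bool (v \<in> A) * w A) - q\<^sup>2) / (q * (1 - q)) = \<alpha> {u, v}"
      using corr[OF that] \<open>q * (1 - q) > 0\<close> unfolding correlation_def var unfolding mean second by simp
    ultimately show ?thesis using q by (simp add: divide_eq_eq mult.assoc)
  qed
qed

lemma ising_weights:
  fixes J :: "'a \<Rightarrow> real ^ 'v::finite"
  assumes ising: "is_tree_ising M J (\<lambda>_. q) \<alpha> E" and q: "0 < q" "q < 1"
    and w_def: "\<And>A. w A = \<P>(\<omega> in M. J \<omega> = indicator_vector A)"
  shows "marginal UNIV w v a = (if a then q else 1 - q)"
    and "{u, v} \<in> E \<Longrightarrow> pair_marginal UNIV w v u True True = q\<^sup>2 + \<alpha> {u, v} * q * (1 - q)"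
    and "pair_marginal UNIV w v u True False = q - pair_marginal UNIV w v u True True"
    and "pair_marginal UNIV w v u False True = q - pair_marginal UNIV w v u True True"
    and "pair_marginal UNIV w v u False False = 1 - 2 * q + pair_marginal UNIV w v u True True"
proof -
  note mom = ising_moments[OF ising q w_def]
  have F: "(\<Sum>A\<in>UNIV. w A * of_bool (v \<notin> A)) = 1 - q" for v
    unfolding mom(2)[of v, symmetric] mom(1)[symmetric] sum_subtractf[symmetric]
    by (intro sum.cong) auto
  show "marginal UNIV w v a = (if a then q else 1 - q)"
    using mom(2)[of v] F[of v] by (simp add: marginal_def mult.commute)
  show "pair_marginal UNIV w v u True True = q\<^sup>2 + \<alpha> {u, v} * q * (1 - q)" if "{u, v} \<in> E"
    using mom(3)[OF that] by (simp add: pair_marginal_def of_bool_conj mult.commute)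
  show TF: "pair_marginal UNIV w v u True False = q - pair_marginal UNIV w v u True True" for v u
    unfolding mom(2)[of v, symmetric] pair_marginal_def sum_subtractf[symmetric] Pow_UNIV
    by (intro sum.cong) auto
  show FT: "pair_marginal UNIV w v u False True = q - pair_marginal UNIV w v u True True"
    unfolding mom(2)[of u, symmetric] pair_marginal_def sum_subtractf[symmetric] Pow_UNIV
    by (intro sum.cong) auto
  have "pair_marginal UNIV w v u False False = (1 - q) - pair_marginal UNIV w v u True False"
    unfolding F[of u, symmetric] pair_marginal_def sum_subtractf[symmetric] Pow_UNIV
    by (intro sum.cong) auto
  then show "pair_marginal UNIV w v u False False = 1 - 2 * q + pair_marginal UNIV w v u True True"
    by (simp add: TF)
qed

text \<open>
  The interaction of an edge is assigned to its lower end, and the normalising constant to the root.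
\<close>

lemma ising_tree_weight:
  fixes J :: "'a \<Rightarrow> real ^ 'v::finite"
  assumes ising: "is_tree_ising M J q \<alpha> E" 
    and E: "E = (\<lambda>v. {pa E r v, v}) ` dsc r" "inj_on (\<lambda>v. {pa E r v, v}) (dsc r)"
    and ne: "\<And>v. v \<noteq> r \<Longrightarrow> pa E r v \<noteq> v"
  obtains \<phi> where "\<And>v a b. 0 < \<phi> v a b"
    "(\<lambda>A. \<P>(\<omega> in M. J \<omega> = indicator_vector A))
      = tree_weight (\<lambda>v. if v = r then r else pa E r v) \<phi> (insert r (dsc r))"
proof -
  obtain \<eta> \<eta>' where \<eta>: "\<And>x. x \<in> binary_vectors \<Longrightarrow>
      \<P>(\<omega> in M. J \<omega> = x) = exp (ising_exponent E \<eta> \<eta>' x - log_partition E \<eta> \<eta>')"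
    using ising by (auto simp: is_tree_ising_def)
  define Z where "Z = log_partition E \<eta> \<eta>'"
  define \<phi> where "\<phi> v a b = (if v = r then exp (\<eta> r * of_bool a - Z)
      else exp (\<eta> v * of_bool a + \<eta>' {pa E r v, v} * (of_bool b * of_bool a)))" for v a b
  have "\<P>(\<omega> in M. J \<omega> = indicator_vector A)
      = tree_weight (\<lambda>v. if v = r then r else pa E r v) \<phi> (insert r (dsc r)) A" for A
  proof -
    have "indicator_vector A \<in> binary_vectors" by (auto simp: indicator_vector_def binary_vectors_def)
    then have "\<P>(\<omega> in M. J \<omega> = indicator_vector A) = exp (ising_exponent E \<eta> \<eta>' (indicator_vector A) - Z)"
      by (simp add: \<eta> Z_def)
    also have "ising_exponent E \<eta> \<eta>' (indicator_vector A)
       = (\<Sum>v\<in>UNIV. \<eta> v * of_bool (v \<in> A)) + (\<Sum>v\<in>dsc r. \<eta>' {pa E r v, v} * (of_bool (pa E r v \<in> A) * of_bool (v \<in> A)))"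
    proof -
      have "(\<Sum>e\<in>E. \<eta>' e * (\<Prod>v\<in>e. indicator_vector A $ v))
         = (\<Sum>v\<in>dsc r. \<eta>' {pa E r v, v} * (\<Prod>v\<in>{pa E r v, v}. indicator_vector A $ v))"
        by (subst E(1), subst sum.reindex[OF E(2)]) simp
      also have "\<dots> = (\<Sum>v\<in>dsc r. \<eta>' {pa E r v, v} * (of_bool (pa E r v \<in> A) * of_bool (v \<in> A)))"
        using ne by (intro sum.cong) (auto simp: dsc_def indicator_vector_def)
      finally show ?thesis by (simp add: ising_exponent_def indicator_vector_def)
    qed
    also have "(\<Sum>v\<in>UNIV. \<eta> v * of_bool (v \<in> A)) = \<eta> r * of_bool (r \<in> A) + (\<Sum>v\<in>dsc r. \<eta> v * of_bool (v \<in> A))"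
      unfolding dsc_def by (rule sum.remove) auto
    finally have "\<P>(\<omega> in M. J \<omega> = indicator_vector A) = exp ((\<eta> r * of_bool (r \<in> A) - Z)
       + (\<Sum>v\<in>dsc r. \<eta> v * of_bool (v \<in> A) + \<eta>' {pa E r v, v} * (of_bool (pa E r v \<in> A) * of_bool (v \<in> A))))"
      by (simp add: sum.distrib algebra_simps)
    also have "\<dots> = tree_weight (\<lambda>v. if v = r then r else pa E r v) \<phi> (insert r (dsc r)) A"
    proof -
      have "r \<notin> dsc r" by (simp add: dsc_def)
      then show ?thesis
        unfolding tree_weight_def exp_add
        by (subst prod.insert) (auto simp: exp_sum \<phi>_def dsc_def intro!: prod.cong)
    qed
    finally show ?thesis .
  qed
  then show ?thesis using that[of \<phi>] by (auto simp: \<phi>_def)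
qed

section \<open>The Poisson field on binary vectors\<close>

text \<open>
  The mass at \<open>x\<close> of the thinning of the count \<open>y\<close> with parameter \<open>a\<close>, plus an independent Poisson
  count of mean \<open>lam (1 - a)\<close>, where both counts are at most one. For \<open>a = 0\<close> the parent has no
  influence and this is the Poisson mass of mean \<open>lam\<close>, which is the law at the root.
\<close>

definition mpmrf_kernel :: "real \<Rightarrow> real \<Rightarrow> bool \<Rightarrow> bool \<Rightarrow> real" where
  "mpmrf_kernel lam a x y =
     exp (- (lam * (1 - a))) *
     (if x then (if y then a + (1 - a) * (lam * (1 - a)) else lam * (1 - a))
      else (if y then 1 - a else 1))"

lemma mpmrf_kernel_nonneg:
  assumes "0 \<le> lam" "0 \<le> a" "a \<le> 1"
  shows "0 \<le> mpmrf_kernel lam a x y"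
  using assms by (auto simp: mpmrf_kernel_def)

lemma mpmrf_kernel_sum_le_1:
  assumes "0 \<le> lam" "0 \<le> a" "a \<le> 1"
  shows "mpmrf_kernel lam a False y + mpmrf_kernel lam a True y \<le> 1"
proof -
  define t where "t = lam * (1 - a)"
  have t: "0 \<le> t" using assms by (simp add: t_def)
  have "mpmrf_kernel lam a False y + mpmrf_kernel lam a True y
      = exp (- t) * (1 + (if y then 1 - a else 1) * t)"
    by (simp add: mpmrf_kernel_def t_def algebra_simps)
  also have "\<dots> \<le> exp (- t) * (1 + t)"
    using t assms by (auto intro!: mult_left_le_one_le)
  also have "\<dots> \<le> exp (- t) * exp t"
    by (intro mult_left_mono exp_ge_add_one_self) auto
  finally show ?thesis by (simp flip: exp_add)
qed

lemma thinning_of_bool: "thinning b (of_bool y) = of_bool (y \<and> b 0)"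
  by (cases y) (simp_all add: thinning_def lessThan_Suc)

text \<open>
  A count of at most one is thinned by the first Bernoulli variable alone, so both the Bernoulli
  sequence and the Poisson variable contribute only finitely many cases.
\<close>

lemma nn_integral_thinning_step:
  fixes lam a :: real
  assumes lam: "0 < lam * (1 - a)" and a: "0 \<le> a" "a \<le> 1"
  shows "(\<integral>\<^sup>+ j. emeasure (\<Pi>\<^sub>M i\<in>(UNIV::nat set). measure_pmf (bernoulli_pmf a))
      {b \<in> space (\<Pi>\<^sub>M i\<in>UNIV. measure_pmf (bernoulli_pmf a)). thinning b (of_bool y) + j = of_bool x}
     \<partial>measure_pmf (poisson_pmf (lam * (1 - a)))) = ennreal (mpmrf_kernel lam a x y)"
proof -
  let ?B = "\<Pi>\<^sub>M i\<in>(UNIV::nat set). measure_pmf (bernoulli_pmf a)"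
  let ?P = "poisson_pmf (lam * (1 - a))"
  interpret B: product_prob_space "\<lambda>i. measure_pmf (bernoulli_pmf a)" "UNIV :: nat set"
    by unfold_locales
  have B: "emeasure ?B {b \<in> space ?B. thinning b (of_bool y) + j = of_bool x}
     = (\<Sum>t\<in>UNIV. ennreal (pmf (bernoulli_pmf a) t) * indicator {j. of_bool (y \<and> t) + j = (of_bool x :: nat)} j)" for j
  proof -
    have "emeasure ?B {b \<in> space ?B. thinning b (of_bool y) + j = of_bool x}
      = emeasure ?B ((\<lambda>b. b 0) -` {t. of_bool (y \<and> t) + j = (of_bool x :: nat)} \<inter> space ?B)"
      by (intro arg_cong[where f = "emeasure ?B"]) (auto simp: thinning_of_bool)
    also have "\<dots> = emeasure (distr ?B (measure_pmf (bernoulli_pmf a)) (\<lambda>b. b 0)) {t. of_bool (y \<and> t) + j = (of_bool x :: nat)}"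
      by (subst emeasure_distr) auto
    also have "distr ?B (measure_pmf (bernoulli_pmf a)) (\<lambda>b. b 0) = measure_pmf (bernoulli_pmf a)"
      using B.PiM_component[of 0] by simp
    also have "emeasure (measure_pmf (bernoulli_pmf a)) {t. of_bool (y \<and> t) + j = (of_bool x :: nat)}
      = (\<Sum>t\<in>UNIV. ennreal (pmf (bernoulli_pmf a) t) * indicator {j. of_bool (y \<and> t) + j = (of_bool x :: nat)} j)"
      by (subst nn_integral_indicator[symmetric], simp, subst nn_integral_measure_pmf_support[of UNIV])
        (simp_all only: finite mult.commute indicator_def UNIV_I mem_Collect_eq simp_thms zero_le)
    finally show ?thesis .
  qed
  have P: "emeasure (measure_pmf ?P) {j. of_bool c + j = (of_bool x :: nat)}
    = ennreal (if c then (if x then exp (- (lam * (1 - a))) else 0)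
       else exp (- (lam * (1 - a))) * (if x then lam * (1 - a) else 1))" for c
  proof -
    have "{j. of_bool c + j = (of_bool x :: nat)} = (if c then (if x then {0} else {}) else {of_bool x})"
      by auto
    then show ?thesis using lam by (auto simp: emeasure_pmf_single mult.commute)
  qed
  have "(\<integral>\<^sup>+ j. emeasure ?B {b \<in> space ?B. thinning b (of_bool y) + j = of_bool x} \<partial>measure_pmf ?P)
    = (\<Sum>t\<in>UNIV. ennreal (pmf (bernoulli_pmf a) t) * emeasure (measure_pmf ?P) {j. of_bool (y \<and> t) + j = (of_bool x :: nat)})"
    unfolding B by (subst nn_integral_sum) (auto simp: nn_integral_cmult)
  also have "\<dots> = ennreal (mpmrf_kernel lam a x y)"
    using a lam unfolding P
    by (auto simp: UNIV_bool mpmrf_kernel_def algebra_simps simp flip: ennreal_mult ennreal_plus)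
  finally show ?thesis .
qed

lemma mpmrf_recursion_unique:
  fixes depth :: "'v \<Rightarrow> nat"
  assumes depth: "\<And>v. v \<noteq> r \<Longrightarrow> depth (pa E r v) < depth v"
    and n: "n r = l r" "\<forall>v\<in>dsc r. n v = thinning (b v) (n (pa E r v)) + l v"
    and n': "n' r = l r" "\<forall>v\<in>dsc r. n' v = thinning (b v) (n' (pa E r v)) + l v"
  shows "n = n'"
proof
  fix v
  show "n v = n' v"
  proof (induction v rule: measure_induct_rule[of depth])
    case (less v)
    then show ?case using n n' depth[of v] by (cases "v = r") (auto simp: dsc_def)
  qed
qed

lemma measurable_thinning [measurable]:
  "(\<lambda>b. thinning b k) \<in> measurable (\<Pi>\<^sub>M i\<in>(UNIV::nat set). measure_pmf (D i)) (count_space UNIV)"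
proof -
  have "(\<lambda>b. of_bool (b i) :: nat) \<in> measurable (\<Pi>\<^sub>M i\<in>(UNIV::nat set). measure_pmf (D i)) (count_space UNIV)" for i
    by (rule measurable_compose[OF measurable_component_singleton[of i UNIV]]) auto
  then show ?thesis unfolding thinning_def by measurable
qed

lemma measurable_mpmrf_equation:
  fixes E :: "'v::finite set set"
  shows "Measurable.pred (poisson_innovations lam \<alpha> E r \<Otimes>\<^sub>M bernoulli_sequences \<alpha> E r)
    (\<lambda>(l, b). n r = l r \<and> (\<forall>v\<in>dsc r. n v = thinning (b v) (n (pa E r v)) + l v))"
proof -
  have l [measurable]: "(\<lambda>x. fst x v) \<in> measurable (poisson_innovations lam \<alpha> E r \<Otimes>\<^sub>M bernoulli_sequences \<alpha> E r) (count_space UNIV)" for v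
    unfolding poisson_innovations_def
    by (rule measurable_compose[OF measurable_fst], rule measurable_compose[OF measurable_component_singleton[of v UNIV]]) auto
  have b: "(\<lambda>x. thinning (snd x v) k) \<in> measurable (poisson_innovations lam \<alpha> E r \<Otimes>\<^sub>M bernoulli_sequences \<alpha> E r) (count_space UNIV)"
    if "v \<in> dsc r" for v k
    unfolding bernoulli_sequences_def
    by (rule measurable_compose[OF measurable_snd], rule measurable_compose[OF measurable_component_singleton[OF that] measurable_thinning])
  have eq: "Measurable.pred (poisson_innovations lam \<alpha> E r \<Otimes>\<^sub>M bernoulli_sequences \<alpha> E r)
     (\<lambda>x. n v = thinning (snd x v) (n (pa E r v)) + fst x v)" if "v \<in> dsc r" for v
    using b[OF that, measurable] by measurable
  show ?thesis unfolding case_prod_unfold using eq by (intro pred_intros_logic pred_intros_finite) auto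
qed

text \<open>
  The solution is selected from the countable set of vectors of naturals by measurable conditions, of
  which at most one holds.
\<close>

lemma measurable_mpmrf_solution:
  fixes E :: "'v::finite set set" and depth :: "'v \<Rightarrow> nat"
  assumes depth: "\<And>v. v \<noteq> r \<Longrightarrow> depth (pa E r v) < depth v"
  shows "(\<lambda>(l, b). mpmrf_solution E r l b) \<in> measurable
    (poisson_innovations lam \<alpha> E r \<Otimes>\<^sub>M bernoulli_sequences \<alpha> E r) (count_space UNIV)"
  unfolding mpmrf_solution_def case_prod_unfold
proof (rule measurable_THE[where I = UNIV])
  fix n show "Measurable.pred (poisson_innovations lam \<alpha> E r \<Otimes>\<^sub>M bernoulli_sequences \<alpha> E r)
    (\<lambda>x. n r = fst x r \<and> (\<forall>v\<in>dsc r. n v = thinning (snd x v) (n (pa E r v)) + fst x v))"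
    using measurable_mpmrf_equation[where n = n] by (simp add: case_prod_unfold)
next
  show "countable (UNIV :: ('v \<Rightarrow> nat) set)" by (rule countableI_type)
next
  fix x n n'
  assume "n r = fst x r \<and> (\<forall>v\<in>dsc r. n v = thinning (snd x v) (n (pa E r v)) + fst x v)"
    and "n' r = fst x r \<and> (\<forall>v\<in>dsc r. n' v = thinning (snd x v) (n' (pa E r v)) + fst x v)"
  then show "n = n'"
    by (elim conjE) (rule mpmrf_recursion_unique[where depth = depth and r = r and E = E, OF depth])
qed simp

text \<open>
  If the recursion holds at the binary vector of \<open>A\<close>, then that vector is its solution. With the values
  at all parents fixed, the equation of the vertex \<open>v\<close> involves only the innovation and the Bernoulli
  sequence of \<open>v\<close>, so by independence the probability that all equations hold is the product of the
  transition masses.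
\<close>

lemma MPMRF_binary_lower_bound:
  fixes E :: "'v::finite set set" and depth :: "'v \<Rightarrow> nat"
  assumes depth: "\<And>v. v \<noteq> r \<Longrightarrow> depth (pa E r v) < depth v"
    and lam: "0 < lam" and \<alpha>: "\<And>v. v \<noteq> r \<Longrightarrow> \<alpha> {pa E r v, v} \<in> {0..<1}"
  shows "ennreal (\<Prod>v\<in>UNIV. mpmrf_kernel lam (if v = r then 0 else \<alpha> {pa E r v, v}) (v \<in> A) (pa E r v \<in> A))
    \<le> emeasure (MPMRF lam \<alpha> E r) {\<chi> v. of_bool (v \<in> A)}"
proof -
  let ?P = "poisson_innovations lam \<alpha> E r" and ?B = "bernoulli_sequences \<alpha> E r"
  let ?p = "\<lambda>v. measure_pmf (poisson_pmf (if v = r then lam else lam * (1 - \<alpha> {pa E r v, v})))"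
  let ?b = "\<lambda>v. \<Pi>\<^sub>M i\<in>(UNIV::nat set). measure_pmf (bernoulli_pmf (\<alpha> {pa E r v, v}))"
  define n :: "'v \<Rightarrow> nat" where "n v = of_bool (v \<in> A)" for v
  let ?K = "\<lambda>v. mpmrf_kernel lam (if v = r then 0 else \<alpha> {pa E r v, v}) (v \<in> A) (pa E r v \<in> A)"
  interpret b1: product_prob_space "\<lambda>i::nat. measure_pmf (bernoulli_pmf (\<alpha> {pa E r v, v}))" UNIV for v
    by unfold_locales
  interpret p: product_prob_space ?p UNIV by unfold_locales
  interpret b: product_prob_space ?b "dsc r" by unfold_locales
  interpret P: prob_space ?P unfolding poisson_innovations_def by (rule p.prob_space_axioms)
  interpret B: prob_space ?B unfolding bernoulli_sequences_def by (rule b.prob_space_axioms)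
  \<comment> \<open>All equations hold at \<open>n\<close>; for fixed innovations this is a product event in the Bernoulli sequences.\<close>
  define Ev where "Ev = {x \<in> space (?P \<Otimes>\<^sub>M ?B). case x of (l, b) \<Rightarrow>
    n r = l r \<and> (\<forall>v\<in>dsc r. n v = thinning (b v) (n (pa E r v)) + l v)}"
  have Ev: "Ev \<in> sets (?P \<Otimes>\<^sub>M ?B)"
    unfolding Ev_def by (intro predE measurable_mpmrf_equation)
  define G where "G v j = {s \<in> space (?b v). thinning s (n (pa E r v)) + j = n v}" for v j
  define g where "g v j = (if v = r then indicator {n r} j else emeasure (?b v) (G v j))" for v j
  have G: "G v j \<in> sets (?b v)" for v j unfolding G_def by measurable
  have slice: "emeasure ?B (Pair l -` Ev) = (\<Prod>v\<in>UNIV. g v (l v))" if "l \<in> space ?P" for l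
  proof (cases "l r = n r")
    case True
    then have "Pair l -` Ev = (\<Pi>\<^sub>E v\<in>dsc r. G v (l v))"
      using that unfolding Ev_def G_def bernoulli_sequences_def
      by (auto simp: set_eq_iff space_pair_measure space_PiM PiE_iff eq_commute)
    moreover have "emeasure ?B (\<Pi>\<^sub>E v\<in>dsc r. G v (l v)) = (\<Prod>v\<in>dsc r. emeasure (?b v) (G v (l v)))"
      unfolding bernoulli_sequences_def by (intro b.emeasure_PiM G) auto
    moreover have "\<dots> = (\<Prod>v\<in>dsc r. g v (l v))" by (intro prod.cong) (auto simp: g_def dsc_def)
    ultimately show ?thesis using True by (simp add: prod.remove[of UNIV r] dsc_def g_def)
  next
    case False
    then have "Pair l -` Ev = {}" by (auto simp: Ev_def)
    with False show ?thesis by (simp add: prod.remove[of UNIV r] g_def)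
  qed
  have factor: "(\<integral>\<^sup>+ j. g v j \<partial>?p v) = ennreal (?K v)" for v
  proof (cases "v = r")
    case True
    then show ?thesis using lam
      by (auto simp: g_def n_def mpmrf_kernel_def emeasure_pmf_single mult.commute)
  next
    case False
    then show ?thesis using lam \<alpha>[of v] unfolding g_def G_def n_def
      by (simp only: if_False) (intro nn_integral_thinning_step; simp)
  qed
  have "ennreal (\<Prod>v\<in>UNIV. ?K v) = (\<Prod>v\<in>UNIV. \<integral>\<^sup>+ j. g v j \<partial>?p v)"
    unfolding factor using lam \<alpha>
    by (intro prod_ennreal[symmetric] mpmrf_kernel_nonneg) (auto intro: less_imp_le)
  also have "\<dots> = (\<integral>\<^sup>+ l. (\<Prod>v\<in>UNIV. g v (l v)) \<partial>?P)"
    unfolding poisson_innovations_def by (intro p.product_nn_integral_prod[symmetric]) auto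
  also have "\<dots> = (\<integral>\<^sup>+ l. emeasure ?B (Pair l -` Ev) \<partial>?P)"
    by (intro nn_integral_cong) (simp add: slice)
  also have "\<dots> = emeasure (?P \<Otimes>\<^sub>M ?B) Ev"
    by (rule B.emeasure_pair_measure_alt[OF Ev, symmetric])
  also have "\<dots> \<le> emeasure (MPMRF lam \<alpha> E r) {\<chi> v. of_bool (v \<in> A)}"
  proof -
    have "(\<lambda>(l, b). \<chi> v. real (mpmrf_solution E r l b v)) \<in> borel_measurable (?P \<Otimes>\<^sub>M ?B)"
      using measurable_compose[OF measurable_mpmrf_solution[where depth = depth and r = r and E = E,
          OF depth], of "\<lambda>n. \<chi> v. real (n v)" borel lam \<alpha>]
      by (simp add: case_prod_unfold)
    moreover have "mpmrf_solution E r l b = n" if "(l, b) \<in> Ev" for l b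
    proof -
      have n: "n r = l r" "\<forall>v\<in>dsc r. n v = thinning (b v) (n (pa E r v)) + l v"
        using that by (simp_all add: Ev_def)
      show ?thesis
        unfolding mpmrf_solution_def
      proof (rule the_equality)
        fix n' assume "n' r = l r \<and> (\<forall>v\<in>dsc r. n' v = thinning (b v) (n' (pa E r v)) + l v)"
        then show "n' = n"
          by (elim conjE) (rule mpmrf_recursion_unique[where depth = depth and r = r and E = E, OF depth _ _ n])
      qed (use n in blast)
    qed
    ultimately show ?thesis
      unfolding MPMRF_def
      by (subst emeasure_distr)
        (auto intro!: emeasure_mono measurable_sets simp: Ev_def vec_eq_iff n_def)
  qed
  finally show ?thesis .
qed

section \<open>The total variation bound\<close>

text \<open>
  Among the four transitions only those into \<open>1\<close> have larger mass under the Ising model, as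
  \<open>1 - t \<le> exp (- t)\<close> and \<open>1 - q \<le> exp (- t)\<close> for \<open>t = q (1 - a)\<close>. The two positive parts add up to
  \<open>q (1 - exp (- t) (1 - t a))\<close>. With \<open>s = q a\<close> one has \<open>exp (- q) = exp (- t) exp (- s)\<close>, so it remains to
  see \<open>exp (- s) \<le> 1 - t a\<close>, which follows from \<open>(1 + s) (1 - t a) = 1 + s a (1 - t)\<close>.
\<close>

lemma mpmrf_ising_edge_bound:
  fixes q a :: real and p :: "bool \<Rightarrow> bool \<Rightarrow> real"
  assumes q: "0 < q" "q < 1" and a: "0 \<le> a" "a \<le> 1"
    and TT: "p True True = q\<^sup>2 + a * q * (1 - q)"
    and m: "m True = q" "m False = 1 - q"
    and p: "p True False = q - p True True" "p False True = q - p True True"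
      "p False False = 1 - 2 * q + p True True"
  shows "(\<Sum>x\<in>UNIV. \<Sum>y\<in>UNIV. max 0 (p x y - m y * mpmrf_kernel q a x y)) \<le> q * (1 - exp (- q))"
proof -
  define t where "t = q * (1 - a)"
  define e where "e = exp (- t)"
  have t: "0 \<le> t" "t \<le> q" using q a by (simp_all add: t_def mult_left_le)
  have e: "0 \<le> e" "e \<le> 1" "1 - t \<le> e"
    using t exp_ge_add_one_self[of "- t"] by (simp_all add: e_def)
  have FF: "p False False - m False * mpmrf_kernel q a False False = (1 - q) * ((1 - t) - e)"
    by (simp add: p TT m mpmrf_kernel_def e_def t_def algebra_simps power2_eq_square)
  have FT: "p False True - m True * mpmrf_kernel q a False True = q * (1 - a) * ((1 - q) - e)"
    by (simp add: p TT m mpmrf_kernel_def e_def t_def algebra_simps power2_eq_square)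
  have TF: "p True False - m False * mpmrf_kernel q a True False = (1 - q) * t * (1 - e)"
    by (simp add: p TT m mpmrf_kernel_def e_def t_def algebra_simps power2_eq_square)
  have TT': "p True True - m True * mpmrf_kernel q a True True
      = q * (a * (1 - e) + (1 - a) * (q - e * t))"
    by (simp add: TT m mpmrf_kernel_def e_def t_def algebra_simps power2_eq_square)
  have "e * t \<le> q" using e t by (meson mult_left_le_one_le order_trans)
  then have "0 \<le> q * (a * (1 - e) + (1 - a) * (q - e * t))" "0 \<le> (1 - q) * t * (1 - e)"
    using q a e t by simp_all
  moreover have "(1 - q) * ((1 - t) - e) \<le> 0" "q * (1 - a) * ((1 - q) - e) \<le> 0"
    using q a e t by (auto intro!: mult_nonneg_nonpos)
  ultimately have "(\<Sum>x\<in>UNIV. \<Sum>y\<in>UNIV. max 0 (p x y - m y * mpmrf_kernel q a x y))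
      = (1 - q) * t * (1 - e) + q * (a * (1 - e) + (1 - a) * (q - e * t))"
    by (simp add: UNIV_bool FF FT TF TT' max_absorb1 max_absorb2 del: mult_le_0_iff zero_le_mult_iff)
  also have "\<dots> = q * (1 - e * (1 - t * a))"
    by (simp add: t_def algebra_simps power2_eq_square)
  also have "\<dots> \<le> q * (1 - exp (- q))"
  proof -
    define s where "s = q * a"
    have s: "0 \<le> s" using q a by (simp add: s_def)
    have "0 \<le> s * (a * (1 - t))" using s a t q by simp
    also have "\<dots> = (1 + s) * (1 - t * a) - 1"
      by (simp add: s_def t_def algebra_simps power2_eq_square)
    finally have "1 \<le> (1 + s) * (1 - t * a)" by simp
    moreover have "t * a \<le> 1" using t a q by (simp add: mult_le_one)
    ultimately have "1 \<le> exp s * (1 - t * a)"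
      using exp_ge_add_one_self[of s] by (meson diff_ge_0_iff_ge mult_right_mono order_trans)
    then have "exp (- s) \<le> 1 - t * a" by (simp add: exp_minus field_simps)
    moreover have "exp (- q) = e * exp (- s)"
      by (simp add: e_def s_def t_def algebra_simps flip: exp_add)
    ultimately show ?thesis using q e by (simp add: mult_left_mono)
  qed
  finally show ?thesis .
qed

lemma d_TV_mpmrf_ising_le:
  fixes E :: "'v::finite set set" and N :: "'a \<Rightarrow> real ^ 'v" and J :: "'b \<Rightarrow> real ^ 'v"
  assumes tree: "is_tree E" and \<alpha>: "\<And>e. e \<in> E \<Longrightarrow> \<alpha> e \<in> {0<..<1}" and q: "0 < q" "q < 1"
    and N: "is_MPMRF M N q \<alpha> E" and J: "is_tree_ising M' J (\<lambda>_. q) \<alpha> E"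
  shows "d_TV M N M' J \<le> real CARD('v) * q * (1 - exp (- q))"
proof -
  from N obtain r where M: "prob_space M" and Nm: "N \<in> borel_measurable M"
    and dist: "distr M borel N = MPMRF q \<alpha> E r" by (auto simp: is_MPMRF_def)
  from J have M': "prob_space M'" and Jm: "J \<in> borel_measurable M'"
    and bin: "AE \<omega> in M'. J \<omega> \<in> binary_vectors" by (auto simp: is_tree_ising_def)
  interpret M: prob_space M by (rule M)
  obtain depth :: "'v \<Rightarrow> nat" where depth: "\<And>v. v \<noteq> r \<Longrightarrow> depth (pa E r v) < depth v"
    and E: "E = (\<lambda>v. {pa E r v, v}) ` dsc r" "inj_on (\<lambda>v. {pa E r v, v}) (dsc r)"
    using tree_rooted[OF tree, where r = r] by blast
  \<comment> \<open>The root is its own parent, so that \<open>tree_weight\<close> gives it a factor of the same form as the others.\<close>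
  define pr where "pr v = (if v = r then r else pa E r v)" for v
  define w where "w A = \<P>(\<omega> in M'. J \<omega> = indicator_vector A)" for A
  \<comment> \<open>With parameter \<open>0\<close> at the root, its kernel is the Poisson law of mean \<open>q\<close> there.\<close>
  define K where "K v = mpmrf_kernel q (if v = r then 0 else \<alpha> {pa E r v, v})" for v
  have edge: "{pa E r v, v} \<in> E" if "v \<noteq> r" for v using that by (subst E(1)) (auto simp: dsc_def)
  have \<alpha>_edge: "0 < \<alpha> {pa E r v, v}" "\<alpha> {pa E r v, v} < 1" if "v \<noteq> r" for v
    using \<alpha>[OF edge[OF that]] by auto
  have ne: "pa E r v \<noteq> v" if "v \<noteq> r" for v using depth[OF that] by auto
  have UNIV: "insert r (dsc r) = UNIV" by (auto simp: dsc_def)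
  obtain \<phi> where \<phi>: "\<And>v a b. 0 < \<phi> v a b" and w: "w = tree_weight pr \<phi> UNIV"
    using ising_tree_weight[OF J E ne] unfolding w_def pr_def UNIV by blast
  note weights = ising_weights[OF J q w_def]
  have N_ge: "tree_weight pr K UNIV A \<le> \<P>(\<omega> in M. N \<omega> = indicator_vector A)" for A
  proof -
    have "tree_weight pr K UNIV A = (\<Prod>v\<in>UNIV. mpmrf_kernel q (if v = r then 0 else \<alpha> {pa E r v, v}) (v \<in> A) (pa E r v \<in> A))"
      unfolding tree_weight_def by (intro prod.cong) (auto simp: K_def pr_def mpmrf_kernel_def)
    also have "ennreal \<dots> \<le> emeasure (MPMRF q \<alpha> E r) {indicator_vector A}"
      unfolding indicator_vector_def using \<alpha>_edge
      by (intro MPMRF_binary_lower_bound[where depth = depth] depth q) (auto intro: less_imp_le)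
    also have "\<dots> = emeasure M {\<omega> \<in> space M. N \<omega> = indicator_vector A}"
      unfolding dist[symmetric] using Nm
      by (subst emeasure_distr) (auto intro!: arg_cong[where f = "emeasure M"])
    finally show ?thesis by (simp add: M.emeasure_eq_measure)
  qed
  have "d_TV M N M' J \<le> (\<Sum>A\<in>UNIV. max 0 (w A - \<P>(\<omega> in M. N \<omega> = indicator_vector A)))"
    unfolding w_def by (rule d_TV_le_if_binary[OF M M' Nm Jm bin])
  also have "\<dots> \<le> (\<Sum>A\<in>UNIV. max 0 (w A - tree_weight pr K UNIV A))"
    using N_ge by (intro sum_mono) (smt (verit))
  also have "\<dots> \<le> root_defect UNIV w (\<lambda>a. K r a a) r + (\<Sum>v\<in>dsc r. edge_defect UNIV w (K v) v (pr v))"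
  proof -
    have "0 \<le> K v a b" for v a b
      unfolding K_def using q \<alpha>_edge[of v] by (intro mpmrf_kernel_nonneg) auto
    moreover have "K v False b + K v True b \<le> 1" for v b
      unfolding K_def using q \<alpha>_edge[of v] by (intro mpmrf_kernel_sum_le_1) auto
    ultimately show ?thesis
      using tree_weight_hybrid[of "dsc r" r pr depth \<phi> K, unfolded UNIV] depth \<phi>
      by (simp add: UNIV w) (simp add: pr_def dsc_def)
  qed
  also have "root_defect UNIV w (\<lambda>a. K r a a) r = q * (1 - exp (- q))"
    using q exp_ge_add_one_self[of "- q"]
    by (simp add: root_defect_def UNIV_bool weights K_def mpmrf_kernel_def max_def algebra_simps)
  also have "(\<Sum>v\<in>dsc r. edge_defect UNIV w (K v) v (pr v)) \<le> (\<Sum>v\<in>dsc r. q * (1 - exp (- q)))"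
  proof (intro sum_mono)
    fix v assume "v \<in> dsc r"
    then have v: "v \<noteq> r" by (simp add: dsc_def)
    then show "edge_defect UNIV w (K v) v (pr v) \<le> q * (1 - exp (- q))"
      unfolding edge_defect_def K_def using \<alpha>_edge[OF v] edge[OF v]
      by (simp only: if_False pr_def) (intro mpmrf_ising_edge_bound q; simp add: weights)
  qed
  also have "(\<Sum>v\<in>dsc r. q * (1 - exp (- q))) = (real CARD('v) - 1) * (q * (1 - exp (- q)))"
    by (simp add: dsc_def card_Diff_singleton of_nat_diff)
  finally show ?thesis by (simp add: algebra_simps)
qed

theorem theorem3:
  fixes E :: "'v::finite set set" and \<alpha> :: "'v set \<Rightarrow> real"
  assumes "is_tree E"
    and "\<forall>e\<in>E. \<alpha> e \<in> {0<..<1}"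
  shows "(\<forall>q\<in>{0<..<1}. \<forall>(M :: 'a measure) N (M' :: 'b measure) J.
            is_MPMRF M N q \<alpha> E \<longrightarrow> is_tree_ising M' J (\<lambda>_. q) \<alpha> E \<longrightarrow>
            d_TV M N M' J \<le> real CARD('v) * q * (1 - exp (- q))) \<and>
         (\<forall>(M :: real \<Rightarrow> 'a measure) N (M' :: real \<Rightarrow> 'b measure) J.
            (\<forall>q\<in>{0<..<1}. is_MPMRF (M q) (N q) q \<alpha> E \<and>
                            is_tree_ising (M' q) (J q) (\<lambda>_. q) \<alpha> E) \<longrightarrow>
            ((\<lambda>q. d_TV (M q) (N q) (M' q) (J q)) \<longlongrightarrow> 0) (at_right 0))"
proof (intro conjI ballI allI impI)
  fix q :: real and M :: "'a measure" and N and M' :: "'b measure" and J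
  assume "q \<in> {0<..<1}" "is_MPMRF M N q \<alpha> E" "is_tree_ising M' J (\<lambda>_. q) \<alpha> E"
  then show "d_TV M N M' J \<le> real CARD('v) * q * (1 - exp (- q))"
    using assms by (intro d_TV_mpmrf_ising_le) auto
next
  fix M :: "real \<Rightarrow> 'a measure" and N and M' :: "real \<Rightarrow> 'b measure" and J
  assume *: "\<forall>q\<in>{0<..<1}. is_MPMRF (M q) (N q) q \<alpha> E \<and> is_tree_ising (M' q) (J q) (\<lambda>_. q) \<alpha> E"
  have small: "\<forall>\<^sub>F q in at_right 0. q \<in> {0<..<1::real}"
    by (rule eventually_at_right_real) simp
  show "((\<lambda>q. d_TV (M q) (N q) (M' q) (J q)) \<longlongrightarrow> 0) (at_right 0)"
  proof (rule real_tendsto_sandwich)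
    show "\<forall>\<^sub>F q in at_right 0. 0 \<le> d_TV (M q) (N q) (M' q) (J q)"
      using small
    proof eventually_elim
      case (elim q)
      then show ?case
        using * by (intro d_TV_nonneg) (auto simp: is_MPMRF_def is_tree_ising_def)
    qed
    show "\<forall>\<^sub>F q in at_right 0. d_TV (M q) (N q) (M' q) (J q) \<le> real CARD('v) * q * (1 - exp (- q))"
      using small
    proof eventually_elim
      case (elim q)
      then show ?case using * assms by (intro d_TV_mpmrf_ising_le[where \<alpha> = \<alpha>]) auto
    qed
    have "((\<lambda>q. real CARD('v) * q * (1 - exp (- q))) \<longlongrightarrow> real CARD('v) * 0 * (1 - exp (- 0))) (at_right 0)"
      by (intro tendsto_intros)
    then show "((\<lambda>q. real CARD('v) * q * (1 - exp (- q))) \<longlongrightarrow> 0) (at_right 0)" by simp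
  qed simp
qed

end
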